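(* Let $n\ge2$ and let $\vec{C}_n$ be the directed cycle on $n$ vertices. Then there exists a constant $0<a<1$ such that $p_2[\vec{C}_n,q]\ge a$ for all $q$ large enough. More precisely, \begin{align*} \lim_{q\to\infty}p_0[\vec{C}_n,q]&=e^{-1},\\ \lim_{q\to\infty}p_1[\vec{C}_n,q]&=e^{-1},\\ \lim_{q\to\infty}p_2[\vec{C}_n,q]&=1-2e^{-1},\\ \lim_{q\to\infty}\frac{1}{|\mathrm{F}[\vec{C}_n,q]|}\sum_{f\in\mathrm{F}[\vec{C}_n,q]}\mathrm{i}(f)&=e^{-1}. \end{align*}
   Context: $\vec{C}_n$ has vertex set $V=\{1,\dots,n\}$ and arcs $(v-1,v)$ for $v\in V$, indices modulo $n$. For an integer $q\ge2$ let $[q]=\{0,\dots,q-1\}$. For $f=(f_1,\dots,f_n):[q]^n\to[q]^n$, the interaction graph $G(f)$ has vertex set $V$ and an arc $(u,v)$ if and only if there exist $x,y\in[q]^n$ differing only in coordinate $u$ with $f_v(x)\ne f_v(y)$. For a directed graph $D$ on $V$, $\mathrm{F}[D,q]$ is the set of all $f:[q]^n\to[q]^n$ with $G(f)=D$. Let $\mathrm{Fix}(f)$ be the set of fixed points of $f$. Then $p_0[D,q]$, $p_1[D,q]$, $p_2[D,q]$ are the proportions of $f\in\mathrm{F}[D,q]$ with $|\mathrm{Fix}(f)|=0$, $|\mathrm{Fix}(f)|=1$, $|\mathrm{Fix}(f)|\ge2$ respectively. With $d_{\mathrm H}$ the Hamming distance, $\mathrm{i}(f)=\min_{x\in[q]^n}d_{\mathrm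 H}(x,f(x))$. *)

theory Defs
  imports Complex_Main "HOL-Library.FuncSet" "Graph_Theory.Pair_Digraph"
begin

text \<open>
  \<open>[q]\<^sup>V\<close>, with \<open>[q] = {0, \<dots>, q - 1}\<close>. Configurations are extensional
  (\<open>undefined\<close> outside \<open>V\<close>), so that they are in bijection with the tuples.
\<close>
definition configs :: "'v set \<Rightarrow> nat \<Rightarrow> ('v \<Rightarrow> nat) set" where
  "configs V q = V \<rightarrow>\<^sub>E {..<q}"

text \<open>The directed cycle; the index \<open>0\<close>, read modulo \<open>n\<close>, is the vertex \<open>n\<close>.\<close>
definition directed_cycle :: "nat \<Rightarrow> nat pair_pre_digraph" where
  "directed_cycle n =
    \<lparr> pverts = {1..n}, parcs = {(if v = 1 then n else v - 1, v) | v. v \<in> {1..n}} \<rparr>"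

definition interaction_graph ::
  "'v set \<Rightarrow> nat \<Rightarrow> (('v \<Rightarrow> nat) \<Rightarrow> ('v \<Rightarrow> nat)) \<Rightarrow> 'v pair_pre_digraph" where
  "interaction_graph V q f =
    \<lparr> pverts = V,
      parcs = {(u, v). u \<in> V \<and> v \<in> V \<and>
        (\<exists>x\<in>configs V q. \<exists>y\<in>configs V q.
          x u \<noteq> y u \<and> (\<forall>w\<in>V - {u}. x w = y w) \<and> f x v \<noteq> f y v)} \<rparr>"

text \<open>
  \<open>F[D, q]\<close>. Self-maps of \<open>[q]\<^sup>V\<close> are again extensional, so that each of them is
  counted exactly once in the cardinalities below.
\<close>
definition networks ::
  "'v pair_pre_digraph \<Rightarrow> nat \<Rightarrow> (('v \<Rightarrow> nat) \<Rightarrow> ('v \<Rightarrow> nat)) set" where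
  "networks D q =
    {f \<in> configs (pverts D) q \<rightarrow>\<^sub>E configs (pverts D) q.
      interaction_graph (pverts D) q f = D}"

definition Fix :: "'v set \<Rightarrow> nat \<Rightarrow> (('v \<Rightarrow> nat) \<Rightarrow> ('v \<Rightarrow> nat)) \<Rightarrow> ('v \<Rightarrow> nat) set" where
  "Fix V q f = {x \<in> configs V q. f x = x}"

definition p0 :: "'v pair_pre_digraph \<Rightarrow> nat \<Rightarrow> real" where
  "p0 D q = real (card {f \<in> networks D q. card (Fix (pverts D) q f) = 0})
            / real (card (networks D q))"

definition p1 :: "'v pair_pre_digraph \<Rightarrow> nat \<Rightarrow> real" where
  "p1 D q = real (card {f \<in> networks D q. card (Fix (pverts D) q f) = 1})
            / real (card (networks D q))"

definition p2 :: "'v pair_pre_digraph \<Rightarrow> nat \<Rightarrow> real" where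
  "p2 D q = real (card {f \<in> networks D q. card (Fix (pverts D) q f) \<ge> 2})
            / real (card (networks D q))"

definition hamming_dist :: "'v set \<Rightarrow> ('v \<Rightarrow> nat) \<Rightarrow> ('v \<Rightarrow> nat) \<Rightarrow> nat" where
  "hamming_dist V x y = card {v \<in> V. x v \<noteq> y v}"

definition instability :: "'v set \<Rightarrow> nat \<Rightarrow> (('v \<Rightarrow> nat) \<Rightarrow> ('v \<Rightarrow> nat)) \<Rightarrow> nat" where
  "instability V q f = Min ((\<lambda>x. hamming_dist V x (f x)) ` configs V q)"

end

theory Submission
  imports Defs "HOL-Analysis.Uniform_Limit"
begin

text \<open>
  A network on the cycle is a family of \<open>n\<close> nonconstant maps \<open>h\<^sub>v : [q] \<rightarrow> [q]\<close>, and two fixed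
  points that agree in one coordinate are equal. Hence \<open>k\<close> distinct fixed points prescribe
  \<open>k\<close> distinct values of each \<open>h\<^sub>v\<close> at \<open>k\<close> distinct arguments, which makes the factorial moments
  of the number of fixed points explicit \<open>n\<close>-th powers. They are at most \<open>1\<close> and tend to \<open>1\<close>, the
  factorial moments of the Poisson distribution of parameter \<open>1\<close>; inclusion-exclusion and
  Tannery's theorem turn this into the limits of \<open>p\<^sub>0\<close> and \<open>p\<^sub>1\<close>. Finally, propagating any value
  once around the cycle gives a configuration with at most one unstable coordinate, so the
  instability is the indicator of having no fixed point.
\<close>

section \<open>Nonconstant self-maps with prescribed values\<close>

definition nonconstant_maps :: "nat \<Rightarrow> (nat \<Rightarrow> nat) set" where
  "nonconstant_maps q = {g \<in> {..<q} \<rightarrow>\<^sub>E {..<q}. \<exists>a<q. \<exists>b<q. g a \<noteq> g b}"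

definition cycle_pred :: "nat \<Rightarrow> nat \<Rightarrow> nat" where
  "cycle_pred n v = (if v = 1 then n else v - 1)"

definition cycle_network ::
  "nat \<Rightarrow> nat \<Rightarrow> (nat \<Rightarrow> nat \<Rightarrow> nat) \<Rightarrow> (nat \<Rightarrow> nat) \<Rightarrow> nat \<Rightarrow> nat" where
  "cycle_network n q h =
    (\<lambda>x\<in>configs {1..n} q. \<lambda>v\<in>{1..n}. h v (x (cycle_pred n v)))"

text \<open>
  Of the \<open>q\<^bsup>q-k\<^esup>\<close> maps with \<open>k\<close> prescribed distinct values, the subtracted ones are constant.
\<close>
definition interpolating_count :: "nat \<Rightarrow> nat \<Rightarrow> nat" where
  "interpolating_count q k =
    q ^ (q - k) - (if k = 0 then q else if k = 1 then 1 else 0)"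

text \<open>The interpolating maps form a product set with \<open>q - k\<close> free factors. A
  constant map is among them only if all \<open>b i\<close> coincide; as \<open>b\<close> is
  injective, this leaves all \<open>q\<close> constants for \<open>k = 0\<close>, one for
  \<open>k = 1\<close> and none for \<open>k \<ge> 2\<close>.\<close>

lemma card_interpolating_nonconstant_maps:
  assumes a: "a \<in> {..<k} \<rightarrow> {..<q}" "inj_on a {..<k}"
    and b: "b \<in> {..<k} \<rightarrow> {..<q}" "inj_on b {..<k}"
    and q: "q \<ge> 1"
  shows "card {g \<in> nonconstant_maps q. \<forall>i<k. g (a i) = b i} = interpolating_count q k"
proof -
  define M where "M = {g \<in> {..<q} \<rightarrow>\<^sub>E {..<q}. \<forall>i<k. g (a i) = b i}"
  define C where "C = {c \<in> {..<q}. \<forall>i<k. b i = c}"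
  define K where "K = (\<lambda>c. \<lambda>x\<in>{..<q}. c) ` C"
  define B where "B y = (if y \<in> a ` {..<k} then {b (inv_into {..<k} a y)} else {..<q})" for y
  have fin: "finite M"
    unfolding M_def by (rule finite_subset[of _ "{..<q} \<rightarrow>\<^sub>E {..<q}"]) (auto intro: finite_PiE)
  have "M = Pi\<^sub>E {..<q} B"
  proof (intro equalityI subsetI)
    fix g assume "g \<in> M"
    then show "g \<in> Pi\<^sub>E {..<q} B"
      using a(2) by (auto simp: M_def B_def PiE_iff)
  next
    fix g assume g: "g \<in> Pi\<^sub>E {..<q} B"
    have 1: "g (a i) = b i" if "i < k" for i
    proof -
      have "a i \<in> {..<q}" using a(1) that by auto
      then have "g (a i) \<in> B (a i)" using g by (auto simp: PiE_iff)
      then show ?thesis using that a(2) by (auto simp: B_def)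
    qed
    have "B y \<subseteq> {..<q}" for y
      using b(1) a(2) by (auto simp: B_def)
    with g 1 show "g \<in> M" by (auto simp: M_def PiE_iff)
  qed
  then have "card M = (\<Prod>y<q. card (B y))" by (simp add: card_PiE)
  also have "\<dots> = (\<Prod>y\<in>{..<q} - a ` {..<k}. q)"
    by (rule prod.mono_neutral_cong_right) (auto simp: B_def)
  also have "\<dots> = q ^ (q - k)"
    using a by (simp add: card_Diff_subset card_image image_subset_iff Pi_iff)
  finally have M: "card M = q ^ (q - k)" .
  have "inj_on (\<lambda>c. \<lambda>x\<in>{..<q}. c) C"
  proof (rule inj_onI)
    fix c d assume "(\<lambda>x\<in>{..<q}. c) = (\<lambda>x\<in>{..<q}. d)"
    from fun_cong[OF this, of 0] q show "c = d" by simp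
  qed
  then have "card K = card C" unfolding K_def by (rule card_image)
  also have "\<dots> = (if k = 0 then q else if k = 1 then 1 else 0)"
  proof -
    consider "k = 0" | "k = 1" | "k \<ge> 2" by linarith
    then show ?thesis
    proof cases
      case 2
      then have "C = {b 0}" using b(1) by (auto simp: C_def)
      with 2 show ?thesis by simp
    next
      case 3
      then have "b 0 \<noteq> b 1" using inj_onD[OF b(2), of 0 1] by auto
      moreover have "0 < k" "1 < k" using 3 by simp_all
      ultimately have "\<not> (\<forall>i<k. b i = c)" for c by metis
      then have "C = {}" by (simp add: C_def)
      with 3 show ?thesis by simp
    qed (simp add: C_def)
  qed
  finally have K: "card K = (if k = 0 then q else if k = 1 then 1 else 0)" .
  have KM: "K \<subseteq> M" using a(1) by (auto simp: K_def C_def M_def Pi_iff split: if_splits)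
  have "g \<in> K" if g: "g \<in> M" "\<forall>a<q. \<forall>b<q. g a = g b" for g
  proof -
    have "g = (\<lambda>x\<in>{..<q}. g 0)"
    proof (rule extensionalityI[of _ "{..<q}"])
      fix x assume x: "x \<in> {..<q}"
      then have "g x = g 0" using g(2) q by (metis lessThan_iff less_le_trans zero_less_one)
      with x show "g x = (\<lambda>x\<in>{..<q}. g 0) x" by simp
    qed (use g(1) in \<open>auto simp: M_def PiE_def\<close>)
    moreover have "g 0 \<in> C"
    proof -
      have "b i = g 0" if "i < k" for i
      proof -
        have "a i < q" using a(1) that by auto
        then have "g (a i) = g 0" using g(2) q by (metis less_le_trans zero_less_one)
        with g(1) that show ?thesis by (simp add: M_def)
      qed
      with g(1) q show ?thesis by (auto simp: C_def M_def)
    qed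
    ultimately show ?thesis unfolding K_def by blast
  qed
  moreover have "g \<notin> K" if "\<exists>a<q. \<exists>b<q. g a \<noteq> g b" for g
    using that by (auto simp: K_def)
  ultimately have "g \<in> K \<longleftrightarrow> \<not> (\<exists>a<q. \<exists>b<q. g a \<noteq> g b)" if "g \<in> M" for g
    using that by blast
  moreover have "{g \<in> nonconstant_maps q. \<forall>i<k. g (a i) = b i} =
      {g \<in> M. \<exists>a<q. \<exists>b<q. g a \<noteq> g b}"
    by (auto simp: nonconstant_maps_def M_def)
  ultimately have "{g \<in> nonconstant_maps q. \<forall>i<k. g (a i) = b i} = M - K" by blast
  then show ?thesis
    using KM fin by (simp add: card_Diff_subset finite_subset M K interpolating_count_def)
qed

section \<open>Networks on the cycle as families of nonconstant maps\<close>

lemma finite_configs: "finite V \<Longrightarrow> finite (configs V q)"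
  unfolding configs_def by (auto intro: finite_PiE)

text \<open>A missing arc only controls pairs of configurations that differ in one coordinate. On
  the way from \<open>x\<close> to \<open>y\<close>, one coordinate at a time, every actual change
  happens at some \<open>u\<close> without an arc to \<open>v\<close>, so component \<open>v\<close>
  never moves.\<close>

lemma networks_component_cong:
  assumes f: "f \<in> networks D q" and fin: "finite (pverts D)"
    and v: "v \<in> pverts D"
    and x: "x \<in> configs (pverts D) q" and y: "y \<in> configs (pverts D) q"
    and eq: "\<And>u. (u, v) \<in> parcs D \<Longrightarrow> x u = y u"
  shows "f x v = f y v"
proof -
  let ?V = "pverts D"
  have D: "interaction_graph ?V q f = D" using f by (simp add: networks_def)
  have no_arc: "f x' v = f y' v"
    if "u \<in> ?V" "(u, v) \<notin> parcs D" "x' \<in> configs ?V q" "y' \<in> configs ?V q"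
      "\<And>w. w \<in> ?V - {u} \<Longrightarrow> x' w = y' w" for u x' y'
  proof (cases "x' u = y' u")
    case True
    then have "x' = y'"
      using that by (intro PiE_ext[of x' ?V _ y']) (auto simp: configs_def)
    then show ?thesis by simp
  next
    case False
    have "(u, v) \<notin> parcs (interaction_graph ?V q f)" using D that(2) by simp
    with False that v show ?thesis unfolding interaction_graph_def by auto
  qed
  \<comment> \<open>\<open>z S\<close> has already switched to \<open>y\<close> on \<open>S\<close>;
    it runs from \<open>x\<close> at the empty set to \<open>y\<close> at the full vertex
    set.\<close>
  define z where "z S = (\<lambda>w. if w \<in> S then y w else x w)" for S
  have z_conf: "z S \<in> configs ?V q" for S
    using x y by (auto simp: z_def configs_def PiE_iff extensional_def)
  have "f (z S) v = f x v" if "finite S" "S \<subseteq> ?V" for S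
    using that
  proof (induction S)
    case empty
    then show ?case by (simp add: z_def)
  next
    case (insert u S)
    have "f (z (insert u S)) v = f (z S) v"
    proof (cases "(u, v) \<in> parcs D")
      case True
      then have "z (insert u S) = z S" using eq by (auto simp: z_def)
      then show ?thesis by simp
    next
      case False
      show ?thesis
        by (rule no_arc[OF _ False z_conf z_conf]) (use insert.prems in \<open>auto simp: z_def\<close>)
    qed
    with insert show ?case by simp
  qed
  from this[OF fin] have "f (z ?V) v = f x v" by simp
  moreover have "z ?V = y"
    using x y by (auto simp: z_def configs_def PiE_iff extensional_def)
  ultimately show ?thesis by simp
qed

lemma cycle_pred_mem: "v \<in> {1..n} \<Longrightarrow> cycle_pred n v \<in> {1..n}"
  by (auto simp: cycle_pred_def)

lemma directed_cycle_simps [simp]: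
  "pverts (directed_cycle n) = {1..n}"
  "(u, v) \<in> parcs (directed_cycle n) \<longleftrightarrow> v \<in> {1..n} \<and> u = cycle_pred n v"
  by (auto simp: directed_cycle_def cycle_pred_def)

lemma cycle_network_apply:
  "x \<in> configs {1..n} q \<Longrightarrow> v \<in> {1..n} \<Longrightarrow>
    cycle_network n q h x v = h v (x (cycle_pred n v))"
  by (simp add: cycle_network_def)

lemma configs_mem_lessThan: "x \<in> configs V q \<Longrightarrow> v \<in> V \<Longrightarrow> x v < q"
  by (auto simp: configs_def)

lemma constant_config: "a < q \<Longrightarrow> (\<lambda>v\<in>V. a) \<in> configs V q"
  by (auto simp: configs_def)

text \<open>Component \<open>v\<close> reads only its predecessor, so no other arc can enter
  \<open>v\<close>; nonconstancy of \<open>h v\<close> produces the remaining one.\<close>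

lemma cycle_network_in_networks:
  assumes h: "h \<in> {1..n} \<rightarrow>\<^sub>E nonconstant_maps q"
  shows "cycle_network n q h \<in> networks (directed_cycle n) q"
proof -
  let ?V = "{1..n}" and ?f = "cycle_network n q h"
  have hv: "h v \<in> {..<q} \<rightarrow>\<^sub>E {..<q}" "\<exists>a<q. \<exists>b<q. h v a \<noteq> h v b" if "v \<in> ?V" for v
    using PiE_mem[OF h that] by (simp_all only: nonconstant_maps_def mem_Collect_eq)
  have 1: "?f \<in> configs ?V q \<rightarrow>\<^sub>E configs ?V q"
  proof (rule PiE_I)
    fix x assume x: "x \<in> configs ?V q"
    have "h v (x (cycle_pred n v)) < q" if "v \<in> ?V" for v
      using hv(1)[OF that] configs_mem_lessThan[OF x cycle_pred_mem[OF that]] by auto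
    then show "?f x \<in> configs ?V q"
      using x by (auto simp: cycle_network_def configs_def)
  qed (simp add: cycle_network_def)
  define A where "A u v \<longleftrightarrow> (\<exists>x\<in>configs ?V q. \<exists>y\<in>configs ?V q.
      x u \<noteq> y u \<and> (\<forall>w\<in>?V - {u}. x w = y w) \<and> ?f x v \<noteq> ?f y v)" for u v
  have arc: "A u v \<longleftrightarrow> u = cycle_pred n v" (is "?L \<longleftrightarrow> ?R") if "u \<in> ?V" "v \<in> ?V" for u v
  proof
    assume ?L
    then obtain x y where xy: "x \<in> configs ?V q" "y \<in> configs ?V q"
      "\<forall>w\<in>?V - {u}. x w = y w" "?f x v \<noteq> ?f y v"
      unfolding A_def by blast
    then have "x (cycle_pred n v) \<noteq> y (cycle_pred n v)"
      using that by (auto simp: cycle_network_apply)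
    then show ?R using xy(3) cycle_pred_mem[OF that(2)] by blast
  next
    assume u: ?R
    obtain a b where ab: "a < q" "b < q" "h v a \<noteq> h v b"
      using hv(2)[OF \<open>v \<in> ?V\<close>] by blast
    \<comment> \<open>The constant configuration \<open>a\<close>, altered to \<open>b\<close> at
      the predecessor \<open>u\<close> alone, feeds \<open>h v\<close> the two arguments that it
      separates.\<close>
    define x where "x = (\<lambda>v\<in>?V. a)"
    define y where "y = x(u := b)"
    have x: "x \<in> configs ?V q" unfolding x_def using ab(1) by (rule constant_config)
    have y: "y \<in> configs ?V q"
      using x ab(2) that(1) by (auto simp: y_def configs_def PiE_iff extensional_def)
    have "?f x v \<noteq> ?f y v"
      using x y that ab(3) u by (simp add: cycle_network_apply) (simp add: x_def y_def)
    moreover have "x u \<noteq> y u" using ab(3) that(1) by (auto simp: x_def y_def)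
    moreover have "\<forall>w\<in>?V - {u}. x w = y w" by (simp add: y_def)
    ultimately show ?L unfolding A_def using x y by blast
  qed
  have "interaction_graph ?V q ?f = directed_cycle n"
  proof (rule pair_pre_digraph.equality)
    have "(u, v) \<in> parcs (interaction_graph ?V q ?f) \<longleftrightarrow> u \<in> ?V \<and> v \<in> ?V \<and> u = cycle_pred n v"
      for u v
      unfolding interaction_graph_def A_def[symmetric] pair_pre_digraph.simps mem_Collect_eq prod.case
      using arc[of u v] by blast
    moreover have "(u, v) \<in> parcs (directed_cycle n) \<longleftrightarrow> u \<in> ?V \<and> v \<in> ?V \<and> u = cycle_pred n v"
      for u v
      unfolding directed_cycle_simps using cycle_pred_mem[of v n] by blast
    ultimately show "parcs (interaction_graph ?V q ?f) = parcs (directed_cycle n)"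
      by (simp only: set_eq_iff split_paired_All) simp
  qed (simp_all add: interaction_graph_def)
  with 1 show ?thesis by (simp add: networks_def)
qed

text \<open>Component \<open>v\<close> of a network on the cycle depends only on the value at the
  predecessor, and the presence of the arc makes this dependence nonconstant. Constant
  configurations reach every argument of every \<open>h v\<close>, which yields both injectivity and
  the preimage.\<close>

lemma bij_betw_cycle_network:
  assumes q: "q \<ge> 1"
  shows "bij_betw (cycle_network n q) ({1..n} \<rightarrow>\<^sub>E nonconstant_maps q)
    (networks (directed_cycle n) q)"
  unfolding bij_betw_def
proof
  let ?V = "{1..n}"
  show "inj_on (cycle_network n q) (?V \<rightarrow>\<^sub>E nonconstant_maps q)"
  proof (rule inj_onI)
    fix h h'
    assume h: "h \<in> ?V \<rightarrow>\<^sub>E nonconstant_maps q" and h': "h' \<in> ?V \<rightarrow>\<^sub>E nonconstant_maps q"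
      and eq: "cycle_network n q h = cycle_network n q h'"
    show "h = h'"
    proof (rule PiE_ext[OF h h'])
      fix v assume v: "v \<in> ?V"
      have "h v \<in> {..<q} \<rightarrow>\<^sub>E {..<q}" "h' v \<in> {..<q} \<rightarrow>\<^sub>E {..<q}"
        using PiE_mem[OF h v] PiE_mem[OF h' v] by (simp_all add: nonconstant_maps_def)
      then show "h v = h' v"
      proof (rule PiE_ext)
        fix a assume "a \<in> {..<q}"
        then have c: "(\<lambda>v\<in>?V. a) \<in> configs ?V q" by (intro constant_config) simp
        have "cycle_network n q h (\<lambda>v\<in>?V. a) v = cycle_network n q h' (\<lambda>v\<in>?V. a) v"
          using eq by simp
        then show "h v a = h' v a"
          using cycle_pred_mem[OF v] by (simp only: cycle_network_apply[OF c v]) simp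
      qed
    qed
  qed
  show "cycle_network n q ` (?V \<rightarrow>\<^sub>E nonconstant_maps q) = networks (directed_cycle n) q"
  proof (intro equalityI subsetI)
    fix f assume f: "f \<in> networks (directed_cycle n) q"
    have f_conf: "f \<in> configs ?V q \<rightarrow>\<^sub>E configs ?V q"
      and D: "interaction_graph ?V q f = directed_cycle n"
        using f by (simp_all add: networks_def)
    \<comment> \<open>By \<open>networks_component_cong\<close>, any configuration with value
      \<open>a\<close> at the predecessor of \<open>v\<close> would give the same
      \<open>h v a\<close>.\<close>
    define h where "h = (\<lambda>v\<in>?V. \<lambda>a\<in>{..<q}. f (\<lambda>v\<in>?V. a) v)"
    have fh: "f x v = h v (x (cycle_pred n v))" if "x \<in> configs ?V q" "v \<in> ?V" for x v
    proof -
      let ?a = "x (cycle_pred n v)"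
      have a: "?a < q" using configs_mem_lessThan[OF that(1) cycle_pred_mem[OF that(2)]] .
      have "f x v = f (\<lambda>v\<in>?V. ?a) v"
      proof (rule networks_component_cong[OF f])
        show "(\<lambda>v\<in>?V. ?a) \<in> configs (pverts (directed_cycle n)) q"
          using constant_config[OF a] by simp
        show "x u = (\<lambda>v\<in>?V. ?a) u" if "(u, v) \<in> parcs (directed_cycle n)" for u
          using that cycle_pred_mem[of v n] by simp
      qed (use that in simp_all)
      then show ?thesis using a that by (simp add: h_def)
    qed
    have h: "h \<in> ?V \<rightarrow>\<^sub>E nonconstant_maps q"
    proof (rule PiE_I)
      fix v assume v: "v \<in> ?V"
      have "(cycle_pred n v, v) \<in> parcs (interaction_graph ?V q f)" using v D by simp
      then obtain x y where xy: "x \<in> configs ?V q" "y \<in> configs ?V q" "f x v \<noteq> f y v"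
        unfolding interaction_graph_def by auto
      then have "h v (x (cycle_pred n v)) \<noteq> h v (y (cycle_pred n v))"
        using fh v by auto
      moreover have "x (cycle_pred n v) < q" "y (cycle_pred n v) < q"
        using configs_mem_lessThan[OF xy(1) cycle_pred_mem[OF v]]
          configs_mem_lessThan[OF xy(2) cycle_pred_mem[OF v]] by simp_all
      moreover have "h v a < q" if "a < q" for a
      proof -
        have "f (\<lambda>v\<in>?V. a) \<in> configs ?V q"
          using PiE_mem[OF f_conf constant_config[OF that]] .
        from configs_mem_lessThan[OF this v] show ?thesis using v that by (simp add: h_def)
      qed
      ultimately show "h v \<in> nonconstant_maps q"
        using v unfolding nonconstant_maps_def by (auto simp: h_def)
    qed (simp only: h_def restrict_apply if_False)
    have "cycle_network n q h = f"
    proof (rule extensionalityI[of _ "configs ?V q"])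
      fix x assume x: "x \<in> configs ?V q"
      have "f x \<in> configs ?V q" using f_conf x by auto
      then have "f x \<in> extensional ?V" by (auto simp: configs_def PiE_def)
      then show "cycle_network n q h x = f x"
        using x fh by (intro extensionalityI[of _ ?V]) (auto simp: cycle_network_def)
    qed (use f_conf in \<open>auto simp: cycle_network_def PiE_def\<close>)
    with h show "f \<in> cycle_network n q ` (?V \<rightarrow>\<^sub>E nonconstant_maps q)" by blast
  qed (use cycle_network_in_networks in blast)
qed

section \<open>Fixed points on the cycle\<close>

lemma Fix_cycle_network_iff:
  "x \<in> Fix {1..n} q (cycle_network n q h) \<longleftrightarrow>
    x \<in> configs {1..n} q \<and> (\<forall>v\<in>{1..n}. h v (x (cycle_pred n v)) = x v)"
proof -
  have "cycle_network n q h x = x \<longleftrightarrow> (\<forall>v\<in>{1..n}. h v (x (cycle_pred n v)) = x v)"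
    if x: "x \<in> configs {1..n} q"
  proof
    assume "cycle_network n q h x = x"
    then show "\<forall>v\<in>{1..n}. h v (x (cycle_pred n v)) = x v"
      using cycle_network_apply[OF x, of _ h] by metis
  next
    assume *: "\<forall>v\<in>{1..n}. h v (x (cycle_pred n v)) = x v"
    show "cycle_network n q h x = x"
      using x * by (intro extensionalityI[of _ "{1..n}"])
        (auto simp: cycle_network_def configs_def PiE_def)
  qed
  then show ?thesis by (auto simp: Fix_def)
qed

text \<open>The value of a fixed point at a vertex determines its value at the next vertex and
  hence, going once around, everywhere.\<close>

lemma Fix_cycle_network_eqI:
  assumes x: "x \<in> Fix {1..n} q (cycle_network n q h)"
    and y: "y \<in> Fix {1..n} q (cycle_network n q h)"
    and v: "v \<in> {1..n}" and eq: "x v = y v"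
  shows "x = y"
proof -
  have up: "x w = y w" if "x u = y u" "1 \<le> u" "u \<le> w" "w \<le> n" for u w
    using that(3,4)
  proof (induction w rule: dec_induct)
    case (step w)
    then have "Suc w \<in> {1..n}" and "cycle_pred n (Suc w) = w"
      using that(2) by (auto simp: cycle_pred_def)
    then show ?case
      using step x y unfolding Fix_cycle_network_iff by (metis Suc_leD)
  qed (use that in simp)
  \<comment> \<open>\<open>up\<close> only climbs to larger indices. Climbing from \<open>v\<close>
    to \<open>n\<close>, passing the arc from \<open>n\<close> to \<open>1\<close> and climbing
    again also reaches the vertices below \<open>v\<close>.\<close>
  have "x n = y n" using up[OF eq] v by auto
  moreover have "1 \<in> {1..n}" using v by auto
  moreover have "cycle_pred n 1 = n" by (simp add: cycle_pred_def)
  ultimately have "x 1 = y 1"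
    using x y unfolding Fix_cycle_network_iff by metis
  then have "x w = y w" if "w \<in> {1..n}" for w
    using up[of 1 w] that by auto
  then show ?thesis
    using x y by (intro PiE_ext[of x "{1..n}" "\<lambda>_. {..<q}" y])
      (use x y in \<open>simp_all only: Fix_cycle_network_iff configs_def\<close>)
qed

section \<open>Factorial moments of the number of fixed points\<close>

lemma prod_diff_eq_fact_binomial: "prod ((-) q) {0..<k} = fact k * (q choose k)"
proof (induction k)
  case (Suc k)
  have "Suc k * (q choose Suc k) = (q - k) * (q choose k)"
    by (simp only: binomial_absorption binomial_absorb_comp)
  with Suc show ?case by (simp add: algebra_simps del: mult_Suc mult_Suc_right)
qed simp

lemma card_inj_on_PiE:
  assumes "finite S"
  shows "card {s \<in> {..<k} \<rightarrow>\<^sub>E S. inj_on s {..<k}} = fact k * (card S choose k)"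
  using card_inj_on_subset_funcset[of "{..<k}" S "{..<k}"] assms
  by (simp add: prod_diff_eq_fact_binomial)

text \<open>Transposition turns a \<open>k\<close>-tuple of configurations into a family, indexed by
  \<open>V\<close>, of \<open>k\<close>-tuples of values; the condition becomes injectivity of each
  member, independently.\<close>

lemma card_coordinatewise_inj:
  assumes "finite V"
  shows "card {s \<in> {..<k} \<rightarrow>\<^sub>E configs V q. \<forall>v\<in>V. inj_on (\<lambda>i. s i v) {..<k}} =
    (fact k * (q choose k)) ^ card V"
proof -
  let ?S = "{s \<in> {..<k} \<rightarrow>\<^sub>E configs V q. \<forall>v\<in>V. inj_on (\<lambda>i. s i v) {..<k}}"
  let ?I = "{a \<in> {..<k} \<rightarrow>\<^sub>E {..<q}. inj_on a {..<k}}"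
  have "bij_betw (\<lambda>s. \<lambda>v\<in>V. \<lambda>i\<in>{..<k}. s i v) ?S (V \<rightarrow>\<^sub>E ?I)"
  proof (rule bij_betw_byWitness[where f' = "\<lambda>t. \<lambda>i\<in>{..<k}. \<lambda>v\<in>V. t v i"])
    show "\<forall>s\<in>?S. (\<lambda>i\<in>{..<k}. \<lambda>v\<in>V. (\<lambda>v\<in>V. \<lambda>i\<in>{..<k}. s i v) v i) = s"
      by (auto simp: configs_def PiE_iff extensional_def fun_eq_iff)
    show "\<forall>t\<in>V \<rightarrow>\<^sub>E ?I. (\<lambda>v\<in>V. \<lambda>i\<in>{..<k}. (\<lambda>i\<in>{..<k}. \<lambda>v\<in>V. t v i) i v) = t"
      by (auto simp: PiE_iff extensional_def fun_eq_iff)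
    show "(\<lambda>s. \<lambda>v\<in>V. \<lambda>i\<in>{..<k}. s i v) ` ?S \<subseteq> V \<rightarrow>\<^sub>E ?I"
      by (auto simp: configs_def PiE_iff inj_on_def)
    show "(\<lambda>t. \<lambda>i\<in>{..<k}. \<lambda>v\<in>V. t v i) ` (V \<rightarrow>\<^sub>E ?I) \<subseteq> ?S"
      by (auto simp: configs_def PiE_iff inj_on_def)
  qed
  then have "card ?S = card (V \<rightarrow>\<^sub>E ?I)" by (rule bij_betw_same_card)
  then show ?thesis using assms by (simp add: card_funcsetE card_inj_on_PiE)
qed

lemma finite_nonconstant_maps: "finite (nonconstant_maps q)"
  by (rule finite_subset[of _ "{..<q} \<rightarrow>\<^sub>E {..<q}"])
    (auto simp: nonconstant_maps_def intro: finite_PiE)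

text \<open>Double counting of the pairs of a network and an ordered \<open>k\<close>-tuple of
  distinct fixed points of it. The left side is the \<open>k\<close>-th factorial moment times the
  number of networks; on the right, every admissible tuple belongs to the same number of
  networks.\<close>

lemma sum_fact_binomial_card_Fix:
  assumes n: "n \<ge> 1" and q: "q \<ge> 1"
  shows "(\<Sum>f\<in>networks (directed_cycle n) q. fact k * (card (Fix {1..n} q f) choose k)) =
    (fact k * (q choose k) * interpolating_count q k) ^ n"
proof -
  let ?V = "{1..n}"
  let ?H = "?V \<rightarrow>\<^sub>E nonconstant_maps q"
  let ?S = "{s \<in> {..<k} \<rightarrow>\<^sub>E configs ?V q. \<forall>v\<in>?V. inj_on (\<lambda>i. s i v) {..<k}}"
  define R where "R h s \<longleftrightarrow> (\<forall>v\<in>?V. \<forall>i<k. h v (s i (cycle_pred n v)) = s i v)"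
    for h :: "nat \<Rightarrow> nat \<Rightarrow> nat" and s :: "nat \<Rightarrow> nat \<Rightarrow> nat"
  have fin: "finite ?H" "finite ?S"
    using finite_nonconstant_maps finite_configs[of ?V q]
    by (auto intro!: finite_PiE finite_subset[of ?S "{..<k} \<rightarrow>\<^sub>E configs ?V q"])
  have *: "fact k * (card (Fix ?V q (cycle_network n q h)) choose k) = card {s \<in> ?S. R h s}" for h
  proof -
    let ?F = "Fix ?V q (cycle_network n q h)"
    have "finite ?F" using finite_configs[of ?V q] by (simp add: Fix_def)
    then have "fact k * (card ?F choose k) = card {s \<in> {..<k} \<rightarrow>\<^sub>E ?F. inj_on s {..<k}}"
      by (simp add: card_inj_on_PiE)
    also have "{s \<in> {..<k} \<rightarrow>\<^sub>E ?F. inj_on s {..<k}} = {s \<in> ?S. R h s}"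
    proof (intro equalityI subsetI)
      fix s assume "s \<in> {s \<in> {..<k} \<rightarrow>\<^sub>E ?F. inj_on s {..<k}}"
      then have s: "s \<in> {..<k} \<rightarrow>\<^sub>E ?F" "inj_on s {..<k}" by auto
      \<comment> \<open>Here the cycle enters: distinct fixed points differ at every vertex, not
        merely at some vertex.\<close>
      have "inj_on (\<lambda>i. s i v) {..<k}" if "v \<in> ?V" for v
      proof (rule inj_onI)
        fix i j assume ij: "i \<in> {..<k}" "j \<in> {..<k}" "s i v = s j v"
        have "s i = s j"
          using Fix_cycle_network_eqI[OF PiE_mem[OF s(1) ij(1)] PiE_mem[OF s(1) ij(2)] that ij(3)] .
        with s(2) ij show "i = j" by (simp add: inj_on_def)
      qed
      with s(1) show "s \<in> {s \<in> ?S. R h s}"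
        by (simp add: R_def PiE_iff Fix_cycle_network_iff del: One_nat_def)
    next
      fix s assume s: "s \<in> {s \<in> ?S. R h s}"
      have "inj_on s {..<k}"
      proof (rule inj_onI)
        fix i j assume ij: "i \<in> {..<k}" "j \<in> {..<k}" "s i = s j"
        \<comment> \<open>Conversely, being distinct at a single vertex suffices.\<close>
        have "1 \<in> ?V" using n by simp
        with s have "inj_on (\<lambda>i. s i 1) {..<k}" by blast
        from inj_onD[OF this, of i j] ij show "i = j" by simp
      qed
      with s show "s \<in> {s \<in> {..<k} \<rightarrow>\<^sub>E ?F. inj_on s {..<k}}"
        by (simp add: R_def PiE_iff Fix_cycle_network_iff del: One_nat_def)
    qed
    finally show ?thesis .
  qed
  have R_card: "card {h \<in> ?H. R h s} = interpolating_count q k ^ n" if s: "s \<in> ?S" for s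
  proof -
    have s_conf: "s i \<in> configs ?V q" if "i < k" for i using s that by auto
    have s_less: "(\<lambda>i. s i v) \<in> {..<k} \<rightarrow> {..<q}" if "v \<in> ?V" for v
      using configs_mem_lessThan[OF s_conf that] by simp
    \<comment> \<open>The conditions on the maps \<open>h v\<close> are independent, so the set is a
      product over the vertices.\<close>
    have "{h \<in> ?H. R h s} =
        (\<Pi>\<^sub>E v\<in>?V. {g \<in> nonconstant_maps q. \<forall>i<k. g (s i (cycle_pred n v)) = s i v})"
      by (simp only: R_def set_eq_iff PiE_iff mem_Collect_eq) blast
    then have "card {h \<in> ?H. R h s} =
        (\<Prod>v\<in>?V. card {g \<in> nonconstant_maps q. \<forall>i<k. g (s i (cycle_pred n v)) = s i v})"
      by (simp add: card_PiE)
    also have "\<dots> = (\<Prod>v\<in>?V. interpolating_count q k)"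
    proof (rule prod.cong)
      fix v assume v: "v \<in> ?V"
      have inj: "inj_on (\<lambda>i. s i w) {..<k}" if "w \<in> ?V" for w using s that by blast
      show "card {g \<in> nonconstant_maps q. \<forall>i<k. g (s i (cycle_pred n v)) = s i v} =
          interpolating_count q k"
        using card_interpolating_nonconstant_maps[OF s_less[OF cycle_pred_mem[OF v]]
            inj[OF cycle_pred_mem[OF v]] s_less[OF v] inj[OF v] q] .
    qed simp
    finally show ?thesis by simp
  qed
  have "(\<Sum>f\<in>networks (directed_cycle n) q. fact k * (card (Fix ?V q f) choose k)) =
      (\<Sum>h\<in>?H. fact k * (card (Fix ?V q (cycle_network n q h)) choose k))"
    by (rule sum.reindex_bij_betw[OF bij_betw_cycle_network[OF q], symmetric])
  also have "\<dots> = (\<Sum>h\<in>?H. card {s \<in> ?S. R h s})"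
    by (simp only: *)
  also have "\<dots> = interpolating_count q k ^ n * card ?S"
    by (rule sum_multicount[OF fin]) (use R_card in blast)
  also have "card ?S = (fact k * (q choose k)) ^ n"
    using card_coordinatewise_inj[of ?V] by simp
  finally show ?thesis by (simp only: power_mult_distrib mult_ac)
qed

section \<open>Instability on the cycle\<close>

lemma instability_directed_cycle:
  assumes f: "f \<in> networks (directed_cycle n) q" and n: "n \<ge> 1" and q: "q \<ge> 1"
  shows "instability {1..n} q f = (if Fix {1..n} q f = {} then 1 else 0)"
proof -
  let ?V = "{1..n}"
  obtain h where h: "h \<in> ?V \<rightarrow>\<^sub>E nonconstant_maps q" and fh: "f = cycle_network n q h"
    using bij_betw_cycle_network[OF q, of n] f unfolding bij_betw_def by blast
  have f_conf: "f \<in> configs ?V q \<rightarrow>\<^sub>E configs ?V q" using f by (simp add: networks_def)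
  define D where "D = (\<lambda>x. hamming_dist ?V x (f x)) ` configs ?V q"
  have fin: "finite D" unfolding D_def using finite_configs[of ?V q] by simp
  have D0: "0 \<in> D \<longleftrightarrow> Fix ?V q f \<noteq> {}"
  proof -
    have "hamming_dist ?V x (f x) = 0 \<longleftrightarrow> f x = x" if x: "x \<in> configs ?V q" for x
    proof
      assume "hamming_dist ?V x (f x) = 0"
      then have "x v = f x v" if "v \<in> ?V" for v using that by (auto simp: hamming_dist_def)
      then show "f x = x"
        using x PiE_mem[OF f_conf x] unfolding configs_def by (metis PiE_ext)
    qed (simp add: hamming_dist_def)
    then show ?thesis by (force simp: D_def Fix_def)
  qed
  have D1: "\<exists>d\<in>D. d \<le> 1"
  proof -
    \<comment> \<open>Start with \<open>0\<close> at vertex \<open>1\<close> and apply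
      \<open>h 2\<close>, \<open>h 3\<close>, ... in turn; step \<open>i\<close> of the recursion
      produces the value at vertex \<open>Suc (Suc i)\<close>. Only vertex \<open>1\<close>, which
      is fed by vertex \<open>n\<close>, can be unstable.\<close>
    define x where "x = (\<lambda>v\<in>?V. rec_nat 0 (\<lambda>i a. h (Suc (Suc i)) a) (v - 1))"
    have x1: "x 1 = 0" using n by (simp add: x_def)
    have xS: "x (Suc v) = h (Suc v) (x v)" if v: "v \<ge> 1" "Suc v \<le> n" for v
      using v by (cases v) (simp_all add: x_def)
    have x_less: "x v < q" if "1 \<le> v" "v \<le> n" for v
      using that
    proof (induction v rule: dec_induct)
      case (step v)
      have "h (Suc v) \<in> nonconstant_maps q" using PiE_mem[OF h] step.prems by simp
      then have "h (Suc v) \<in> {..<q} \<rightarrow>\<^sub>E {..<q}" by (simp add: nonconstant_maps_def)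
      from PiE_mem[OF this, of "x v"] step show ?case by (simp add: xS)
    qed (use x1 q in simp)
    then have x: "x \<in> configs ?V q" by (auto simp: configs_def x_def)
    have "f x v = x v" if "v \<in> ?V" "v \<noteq> 1" for v
    proof -
      have "v = Suc (v - 1)" "v - 1 \<ge> 1" "Suc (v - 1) \<le> n" using that by auto
      then have "x v = h v (x (v - 1))" using xS[of "v - 1"] by simp
      then show ?thesis
        unfolding fh cycle_network_apply[OF x that(1)] using that(2) by (simp add: cycle_pred_def)
    qed
    then have "{v \<in> ?V. x v \<noteq> f x v} \<subseteq> {1}" by force
    then have "card {v \<in> ?V. x v \<noteq> f x v} \<le> card {1::nat}" by (intro card_mono) simp_all
    then have "hamming_dist ?V x (f x) \<le> 1" by (simp add: hamming_dist_def)
    with x show ?thesis unfolding D_def by blast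
  qed
  have ne: "D \<noteq> {}" using D1 by auto
  have "Min D \<le> 1" using D1 Min_le[OF fin] by (meson le_trans)
  moreover have "Min D = 0 \<longleftrightarrow> 0 \<in> D"
    using Min_in[OF fin ne] Min_le[OF fin, of 0] by auto
  moreover have "instability ?V q f = Min D" by (simp only: instability_def D_def)
  ultimately show ?thesis using D0 by auto
qed

section \<open>Bounds and limits of the normalised factorial moments\<close>

text \<open>Its \<open>n\<close>-th power is the \<open>k\<close>-th factorial moment of the number
  of fixed points of a uniformly random network.\<close>

definition moment_ratio :: "nat \<Rightarrow> nat \<Rightarrow> real" where
  "moment_ratio q k =
    real (fact k * (q choose k) * interpolating_count q k) / real (interpolating_count q 0)"

lemma interpolating_count_0_pos:
  assumes "q \<ge> 2"
  shows "interpolating_count q 0 > 0"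
proof -
  have "q ^ 1 < q ^ q" using assms by (intro power_strict_increasing) auto
  then show ?thesis by (simp add: interpolating_count_def)
qed

text \<open>This is the domination for Tannery's theorem, uniform in \<open>k\<close> and
  \<open>q\<close>. Equality holds for \<open>k \<le> 1\<close>, and the binomial vanishes for
  \<open>k > q\<close>. Otherwise the numerator is at most \<open>q ^ q - q ^ (q - 1)\<close>, and
  \<open>q ^ (q - 1) \<ge> q\<close> makes up for the \<open>q\<close> constant maps removed in the
  denominator.\<close>

lemma moment_ratio_le_1:
  assumes q: "q \<ge> 2"
  shows "moment_ratio q k \<le> 1"
proof -
  consider "k = 0" | "k = 1" | m where "k = Suc (Suc m)"
    by (metis One_nat_def not0_implies_Suc)
  then have "fact k * (q choose k) * interpolating_count q k \<le> interpolating_count q 0"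
  proof cases
    case 2
    have "q * q ^ (q - 1) = q ^ q" using q by (metis Suc_diff_1 less_le_trans pos2 power_Suc)
    with 2 show ?thesis by (simp add: interpolating_count_def right_diff_distrib')
  next
    case 3
    show ?thesis
    proof (cases "k \<le> q")
      case True
      \<comment> \<open>Bounding every factor by \<open>q\<close> would only give the numerator
        bound \<open>q ^ q\<close>; keeping one factor \<open>q - 1\<close> saves the required
        \<open>q ^ (q - 1)\<close>.\<close>
      have "prod ((-) q) {0..<Suc (Suc m)} \<le> q * (q - 1) * q ^ m" for m
      proof (induction m)
        case (Suc m)
        have "prod ((-) q) {0..<Suc (Suc m)} * (q - Suc (Suc m)) \<le> q * (q - 1) * q ^ m * q"
          by (intro mult_mono Suc) auto
        then show ?case by (simp add: mult_ac)
      qed (simp add: numeral_2_eq_2)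
      then have "prod ((-) q) {0..<k} * q ^ (q - k) \<le> q * (q - 1) * q ^ m * q ^ (q - k)"
        using 3 by (intro mult_mono) auto
      also have "\<dots> = (q - 1) * q ^ (Suc m + (q - k))"
        by (simp add: power_add)
      also have "Suc m + (q - k) = q - 1" using 3 True by simp
      also have "(q - 1) * q ^ (q - 1) = q ^ q - q ^ (q - 1)"
        using q by (cases q) (simp_all add: algebra_simps)
      also have "\<dots> \<le> q ^ q - q ^ 1"
        using q by (intro diff_le_mono2 power_increasing) auto
      finally have "prod ((-) q) {0..<k} * q ^ (q - k) \<le> q ^ q - q ^ 1" .
      moreover have "k \<noteq> 0" "k \<noteq> 1" using 3 by auto
      ultimately show ?thesis
        by (simp add: interpolating_count_def prod_diff_eq_fact_binomial)
    qed (simp add: binomial_eq_0)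
  qed simp
  then show ?thesis
    unfolding moment_ratio_def using interpolating_count_0_pos[OF q]
    by (simp del: of_nat_mult add: divide_le_eq_1)
qed

text \<open>The falling factorial is \<open>q ^ k\<close> times the product. The remaining quotient
  is at least \<open>1\<close>, because multiplication by \<open>q ^ k\<close> turns the constants
  subtracted in \<open>interpolating_count q k\<close> into at most \<open>q\<close>, the number
  subtracted for \<open>k = 0\<close>.\<close>

lemma moment_ratio_ge_prod:
  assumes q: "q \<ge> 2" "q \<ge> k"
  shows "moment_ratio q k \<ge> (\<Prod>i<k. 1 - real i * inverse (real q))"
proof -
  have prod: "real (fact k * (q choose k)) = q ^ k * (\<Prod>i<k. 1 - real i * inverse (real q))"
  proof -
    have "real (fact k * (q choose k)) = (\<Prod>i<k. real (q - i))"
      by (simp only: prod_diff_eq_fact_binomial[symmetric] of_nat_prod atLeast0LessThan)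
    also have "\<dots> = (\<Prod>i<k. real q * (1 - real i * inverse (real q)))"
      using q by (intro prod.cong) (auto simp: field_simps of_nat_diff)
    finally show ?thesis by (simp add: prod.distrib)
  qed
  have pos: "(\<Prod>i<k. 1 - real i * inverse (real q)) \<ge> 0"
    using q by (intro prod_nonneg) (auto simp: field_simps)
  have "interpolating_count q 0 \<le> q ^ k * interpolating_count q k"
  proof -
    have "q ^ k * q ^ (q - k) = q ^ q" using q by (simp flip: power_add)
    then show ?thesis by (auto simp: interpolating_count_def right_diff_distrib')
  qed
  then have "1 \<le> real q ^ k * real (interpolating_count q k) / real (interpolating_count q 0)"
    using interpolating_count_0_pos[OF q(1)]
    by (simp add: le_divide_eq flip: of_nat_power of_nat_mult)
  from mult_left_mono[OF this pos] show ?thesis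
    unfolding moment_ratio_def of_nat_mult[of _ "interpolating_count q k"] prod
    by (simp add: mult_ac)
qed

lemma moment_ratio_tendsto: "(\<lambda>q. moment_ratio q k) \<longlonglongrightarrow> 1"
proof (rule tendsto_sandwich)
  have "(\<lambda>q. \<Prod>i<k. 1 - real i * inverse (real q)) \<longlonglongrightarrow> (\<Prod>i<k. 1 - real i * 0)"
    by (intro tendsto_intros lim_inverse_n)
  then show "(\<lambda>q. \<Prod>i<k. 1 - real i * inverse (real q)) \<longlonglongrightarrow> 1" by simp
  show "\<forall>\<^sub>F q in sequentially. (\<Prod>i<k. 1 - real i * inverse (real q)) \<le> moment_ratio q k"
    using eventually_ge_at_top[of 2] eventually_ge_at_top[of k]
    by eventually_elim (rule moment_ratio_ge_prod)
  show "\<forall>\<^sub>F q in sequentially. moment_ratio q k \<le> 1"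
    using eventually_ge_at_top[of 2] by eventually_elim (rule moment_ratio_le_1)
qed simp

text \<open>Tannery's theorem: the ratios lie between \<open>0\<close> and \<open>1\<close> for
  \<open>q \<ge> 2\<close>, so \<open>\<bar>w k\<bar> / fact k\<close> is a majorant independent of
  \<open>q\<close>.\<close>

lemma suminf_moment_ratio_tendsto:
  fixes w :: "nat \<Rightarrow> real"
  assumes "summable (\<lambda>k. \<bar>w k\<bar> / fact k)"
  shows "(\<lambda>q. \<Sum>k. w k / fact k * moment_ratio q k ^ n) \<longlonglongrightarrow> (\<Sum>k. w k / fact k)"
proof -
  have "(\<lambda>q. w k / fact k * moment_ratio q k ^ n) \<longlonglongrightarrow> w k / fact k * 1 ^ n" for k
    by (intro tendsto_intros moment_ratio_tendsto)
  then have lim: "(\<lambda>q. w k / fact k * moment_ratio q k ^ n) \<longlonglongrightarrow> w k / fact k" for k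
    by simp
  have "norm (w k / fact k * moment_ratio q k ^ n) \<le> \<bar>w k\<bar> / fact k" if "q \<ge> 2" for k q
  proof -
    have "0 \<le> moment_ratio q k" by (simp add: moment_ratio_def)
    then have "moment_ratio q k ^ n \<le> 1" "0 \<le> moment_ratio q k ^ n"
      using moment_ratio_le_1[OF that] by (simp_all add: power_le_one)
    then show ?thesis
      by (simp add: abs_mult mult_left_le del: times_divide_eq_left)
  qed
  then have bound: "\<forall>\<^sub>F (k, q) in at_top \<times>\<^sub>F sequentially.
      norm (w k / fact k * moment_ratio q k ^ n) \<le> \<bar>w k\<bar> / fact k"
    unfolding eventually_prod_sequentially by (intro exI[of _ 2]) auto
  show ?thesis
    using tannerys_theorem[OF lim bound assms] by simp
qed

section \<open>Indicators as inclusion-exclusion series\<close>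

lemma sums_alternating_binomial: "(\<lambda>k. (-1) ^ k * real (x choose k)) sums of_bool (x = 0)"
proof -
  have "(\<lambda>k. (-1) ^ k * real (x choose k)) sums (\<Sum>k\<le>x. (-1) ^ k * real (x choose k))"
    by (rule sums_finite) auto
  \<comment> \<open>The expansion of \<open>(1 - 1) ^ x\<close>.\<close>
  moreover have "(\<Sum>k\<le>x. (-1) ^ k * real (x choose k)) = of_bool (x = 0)"
    using choose_alternating_sum[of x, where ?'a = real] by (cases "x = 0") auto
  ultimately show ?thesis by simp
qed

text \<open>The series is the derivative of \<open>(1 + t) ^ x\<close> at \<open>t = -1\<close>,
  namely \<open>x * (1 + t) ^ (x - 1)\<close>, which is nonzero there only for
  \<open>x = 1\<close>.\<close>

lemma sums_alternating_linear_binomial: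
  "(\<lambda>k. - ((-1) ^ k * real k) * real (x choose k)) sums of_bool (x = 1)"
proof -
  have "(\<lambda>k. (-1) ^ k * real k * real (x choose k)) sums
      (\<Sum>k\<le>x. (-1) ^ k * real k * real (x choose k))"
    by (rule sums_finite) auto
  moreover have "(\<Sum>k\<le>x. (-1) ^ k * real k * real (x choose k)) = - of_bool (x = 1)"
    using choose_alternating_linear_sum[of x, where ?'a = real] by (cases "x = 1") auto
  ultimately show ?thesis using sums_minus by fastforce
qed

lemma sums_alternating_fact: "(\<lambda>k. (-1) ^ k / fact k :: real) sums exp (-1)"
  using exp_converges[of "-1 :: real"] by (simp add: field_simps)

lemma linear_div_fact_Suc: "real (Suc k) / fact (Suc k) = 1 / fact k"
  by (simp add: field_simps del: of_nat_Suc)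

text \<open>The term at \<open>0\<close> vanishes, and cancelling \<open>k\<close> against
  \<open>fact k\<close> turns the shifted series into that of \<open>exp (-1)\<close>.\<close>

lemma sums_alternating_linear_fact:
  "(\<lambda>k. - ((-1) ^ k * real k) / fact k :: real) sums exp (-1)"
proof -
  have "- ((-1) ^ Suc k * real (Suc k)) / fact (Suc k) = (-1) ^ k / fact k" for k
  proof -
    have "- ((-1) ^ Suc k * real (Suc k)) / fact (Suc k) =
        (-1) ^ k * (real (Suc k) / fact (Suc k))"
      by (simp del: fact_Suc of_nat_Suc)
    then show ?thesis by (simp only: linear_div_fact_Suc) simp
  qed
  then have "(\<lambda>k. - ((-1) ^ Suc k * real (Suc k)) / fact (Suc k)) sums exp (-1)"
    using sums_alternating_fact by presburger
  then show ?thesis by (subst (asm) sums_Suc_iff) simp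
qed

lemma summable_inverse_fact: "summable (\<lambda>k. 1 / fact k :: real)"
  using summable_exp[of "1 :: real"] by (simp add: field_simps)

lemma summable_linear_div_fact: "summable (\<lambda>k. real k / fact k :: real)"
  by (subst summable_Suc_iff[symmetric]) (simp only: linear_div_fact_Suc summable_inverse_fact)

section \<open>From factorial moments to means\<close>

text \<open>The binomial expansion of \<open>\<phi>\<close> is averaged term by term; the mean of
  the \<open>k\<close>-th binomial is the \<open>k\<close>-th factorial moment divided by
  \<open>fact k\<close>.\<close>

lemma mean_Fix_statistic:
  fixes w \<phi> :: "nat \<Rightarrow> real"
  assumes n: "n \<ge> 1" and q: "q \<ge> 2"
    and w: "\<And>x. (\<lambda>k. w k * real (x choose k)) sums \<phi> x"
  shows "(\<Sum>f\<in>networks (directed_cycle n) q. \<phi> (card (Fix {1..n} q f))) /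
      real (card (networks (directed_cycle n) q)) =
    (\<Sum>k. w k / fact k * moment_ratio q k ^ n)"
proof -
  let ?N = "networks (directed_cycle n) q" and ?X = "\<lambda>f. card (Fix {1..n} q f)"
  have moment: "(\<Sum>f\<in>?N. fact k * (?X f choose k)) =
      (fact k * (q choose k) * interpolating_count q k) ^ n" for k
    using sum_fact_binomial_card_Fix[OF n, of q] q by simp
  \<comment> \<open>The zeroth moment sums \<open>1\<close> over all networks.\<close>
  have card_N: "card ?N = interpolating_count q 0 ^ n"
    using moment[of 0] by simp
  have "(\<Sum>f\<in>?N. w k * real (?X f choose k)) / real (card ?N) =
      w k / fact k * moment_ratio q k ^ n" for k
  proof -
    have "(\<Sum>f\<in>?N. w k * real (?X f choose k)) =
        w k / fact k * real (\<Sum>f\<in>?N. fact k * (?X f choose k))"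
      by (simp add: sum_distrib_left)
    then show ?thesis
      unfolding moment card_N moment_ratio_def by (simp add: power_divide)
  qed
  moreover have "(\<lambda>k. (\<Sum>f\<in>?N. w k * real (?X f choose k)) / real (card ?N)) sums
      ((\<Sum>f\<in>?N. \<phi> (?X f)) / real (card ?N))"
    by (intro sums_divide sums_sum w)
  ultimately show ?thesis by (simp add: sums_iff)
qed

lemma mean_Fix_statistic_tendsto:
  fixes w \<phi> :: "nat \<Rightarrow> real"
  assumes n: "n \<ge> 1"
    and w: "\<And>x. (\<lambda>k. w k * real (x choose k)) sums \<phi> x"
    and summable: "summable (\<lambda>k. \<bar>w k\<bar> / fact k)"
    and L: "(\<lambda>k. w k / fact k) sums L"
  shows "(\<lambda>q. (\<Sum>f\<in>networks (directed_cycle n) q. \<phi> (card (Fix {1..n} q f))) /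
      real (card (networks (directed_cycle n) q))) \<longlonglongrightarrow> L"
proof (rule Lim_transform_eventually)
  show "(\<lambda>q. \<Sum>k. w k / fact k * moment_ratio q k ^ n) \<longlonglongrightarrow> L"
    using suminf_moment_ratio_tendsto[OF summable] L by (simp add: sums_iff)
  show "\<forall>\<^sub>F q in sequentially. (\<Sum>k. w k / fact k * moment_ratio q k ^ n) =
      (\<Sum>f\<in>networks (directed_cycle n) q. \<phi> (card (Fix {1..n} q f))) /
        real (card (networks (directed_cycle n) q))"
    using eventually_ge_at_top[of 2]
    by eventually_elim (rule mean_Fix_statistic[OF n _ w, symmetric])
qed

section \<open>Limits of the proportions and of the mean instability\<close>

lemma finite_networks_cycle: "finite (networks (directed_cycle n) q)"
proof (rule finite_subset)
  show "networks (directed_cycle n) q \<subseteq> configs {1..n} q \<rightarrow>\<^sub>E configs {1..n} q"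
    by (auto simp only: networks_def directed_cycle_simps)
  show "finite (configs {1..n} q \<rightarrow>\<^sub>E configs {1..n} q)"
    by (intro finite_PiE finite_configs) simp_all
qed

lemma proportion_eq_mean:
  "real (card {f \<in> networks (directed_cycle n) q. P f}) /
      real (card (networks (directed_cycle n) q)) =
    (\<Sum>f\<in>networks (directed_cycle n) q. of_bool (P f)) /
      real (card (networks (directed_cycle n) q))"
  by (simp add: sum_of_bool_eq finite_networks_cycle Int_def)

lemma p0_directed_cycle_tendsto:
  assumes "n \<ge> 1"
  shows "(\<lambda>q. p0 (directed_cycle n) q) \<longlonglongrightarrow> exp (-1)"
  unfolding p0_def proportion_eq_mean directed_cycle_simps
  by (rule mean_Fix_statistic_tendsto[OF assms sums_alternating_binomial _ sums_alternating_fact])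
    (use summable_inverse_fact in simp)

lemma p1_directed_cycle_tendsto:
  assumes "n \<ge> 1"
  shows "(\<lambda>q. p1 (directed_cycle n) q) \<longlonglongrightarrow> exp (-1)"
  unfolding p1_def proportion_eq_mean directed_cycle_simps
  by (rule mean_Fix_statistic_tendsto[OF assms sums_alternating_linear_binomial _
        sums_alternating_linear_fact])
    (use summable_linear_div_fact in \<open>simp add: abs_mult\<close>)

lemma card_networks_cycle_pos:
  assumes "n \<ge> 1" "q \<ge> 2"
  shows "card (networks (directed_cycle n) q) > 0"
  using sum_fact_binomial_card_Fix[of n q 0] interpolating_count_0_pos[of q] assms by simp

text \<open>The three indicators add up to \<open>1\<close> on every network; there is at least one
  network, so their means add up to \<open>1\<close> as well.\<close>

lemma p2_directed_cycle:
  assumes "n \<ge> 1" "q \<ge> 2"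
  shows "p2 (directed_cycle n) q = 1 - p0 (directed_cycle n) q - p1 (directed_cycle n) q"
proof -
  let ?N = "networks (directed_cycle n) q" and ?X = "\<lambda>f. card (Fix {1..n} q f)"
  have "1 = (\<Sum>f\<in>?N. of_bool (?X f = 0) + of_bool (?X f = 1) + of_bool (?X f \<ge> 2)) /
      real (card ?N)"
  proof -
    have "(of_bool (x = 0) + of_bool (x = 1) + of_bool (x \<ge> 2) :: real) = 1" for x :: nat
      by (cases "x = 0"; cases "x = 1") auto
    then show ?thesis using card_networks_cycle_pos[OF assms] by simp
  qed
  then show ?thesis
    unfolding p0_def p1_def p2_def proportion_eq_mean directed_cycle_simps
    by (simp only: sum.distrib add_divide_distrib)
qed

lemma mean_instability_directed_cycle:
  assumes "n \<ge> 1" "q \<ge> 1"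
  shows "1 / real (card (networks (directed_cycle n) q)) *
      (\<Sum>f\<in>networks (directed_cycle n) q. real (instability {1..n} q f)) =
    p0 (directed_cycle n) q"
proof -
  have "real (instability {1..n} q f) = of_bool (card (Fix {1..n} q f) = 0)"
    if "f \<in> networks (directed_cycle n) q" for f
  proof -
    have "finite (Fix {1..n} q f)" using finite_configs[of "{1..n}" q] by (simp add: Fix_def)
    then show ?thesis using instability_directed_cycle[OF that assms] by simp
  qed
  then have "(\<Sum>f\<in>networks (directed_cycle n) q. real (instability {1..n} q f)) =
      (\<Sum>f\<in>networks (directed_cycle n) q. of_bool (card (Fix {1..n} q f) = 0))"
    by (rule sum.cong[OF refl])
  then show ?thesis
    unfolding p0_def proportion_eq_mean directed_cycle_simps by simp
qed

theorem theorem4p7: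
  fixes n :: nat
  assumes "n \<ge> 2"
  shows "(\<exists>a::real. 0 < a \<and> a < 1 \<and> (\<forall>\<^sub>F q in sequentially. p2 (directed_cycle n) q \<ge> a)) \<and>
    (\<lambda>q. p0 (directed_cycle n) q) \<longlonglongrightarrow> exp (-1) \<and>
    (\<lambda>q. p1 (directed_cycle n) q) \<longlonglongrightarrow> exp (-1) \<and>
    (\<lambda>q. p2 (directed_cycle n) q) \<longlonglongrightarrow> 1 - 2 * exp (-1) \<and>
    (\<lambda>q. 1 / real (card (networks (directed_cycle n) q)) *
      (\<Sum>f\<in>networks (directed_cycle n) q. real (instability {1..n} q f))) \<longlonglongrightarrow> exp (-1)"
proof -
  have n: "n \<ge> 1" using assms by simp
  note p0 = p0_directed_cycle_tendsto[OF n] and p1 = p1_directed_cycle_tendsto[OF n]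
  have p2: "(\<lambda>q. p2 (directed_cycle n) q) \<longlonglongrightarrow> 1 - 2 * exp (-1)"
  proof (rule Lim_transform_eventually)
    show "(\<lambda>q. 1 - p0 (directed_cycle n) q - p1 (directed_cycle n) q) \<longlonglongrightarrow> 1 - 2 * exp (-1)"
      using tendsto_diff[OF tendsto_diff[OF tendsto_const p0] p1] by simp
    show "\<forall>\<^sub>F q in sequentially.
        1 - p0 (directed_cycle n) q - p1 (directed_cycle n) q = p2 (directed_cycle n) q"
      using eventually_ge_at_top[of 2] by eventually_elim (simp add: p2_directed_cycle[OF n])
  qed
  have inst: "(\<lambda>q. 1 / real (card (networks (directed_cycle n) q)) *
      (\<Sum>f\<in>networks (directed_cycle n) q. real (instability {1..n} q f))) \<longlonglongrightarrow> exp (-1)"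
    using p0
  proof (rule Lim_transform_eventually)
    show "\<forall>\<^sub>F q in sequentially. p0 (directed_cycle n) q =
        1 / real (card (networks (directed_cycle n) q)) *
          (\<Sum>f\<in>networks (directed_cycle n) q. real (instability {1..n} q f))"
      using eventually_ge_at_top[of 1]
      by eventually_elim (rule mean_instability_directed_cycle[OF n, symmetric])
  qed
  \<comment> \<open>The quadratic Taylor bound gives \<open>exp 1 \<ge> 5 / 2\<close>; hence the
    limit of \<open>p2\<close> is positive.\<close>
  have "exp 1 > (2 :: real)"
    using exp_lower_Taylor_quadratic[of "1 :: real"] by simp
  then have e: "2 * exp (-1) < (1 :: real)" by (simp add: exp_minus field_simps)
  have e_pos: "exp (-1) > (0 :: real)" by simp
  \<comment> \<open>Half the limit of \<open>p2\<close>: positive and strictly below the limit,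
    hence eventually a lower bound.\<close>
  define a :: real where "a = (1 - 2 * exp (-1)) / 2"
  have a: "0 < a" "a < 1 - 2 * exp (-1)" using e by (simp_all add: a_def)
  with e_pos have "a < 1" by linarith
  from order_tendstoD(1)[OF p2 a(2)] have "\<forall>\<^sub>F q in sequentially. a \<le> p2 (directed_cycle n) q"
    by eventually_elim simp
  with a(1) \<open>a < 1\<close> p0 p1 p2 inst show ?thesis by blast
qed

end
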